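(* Let $\mathscr{I}^{\nearrow}_{\infty}(\mathbb{Z})$ be the monoid of all injective monotone partial selfmaps of $\mathbb{Z}$ with cofinite domain and cofinite range. Let $S$ be a semigroup and $h\colon\mathscr{I}^{\nearrow}_{\infty}(\mathbb{Z})\rightarrow S$ a non-annihilating homomorphism. Then either $h$ is a monomorphism or the image $(\mathscr{I}^{\nearrow}_{\infty}(\mathbb{Z}))h$ is a subgroup of $S$.
   Context: A partial map $\alpha\colon\mathbb{Z}\rightharpoonup\mathbb{Z}$ is monotone if $n\leqslant m$ implies $(n)\alpha\leqslant(m)\alpha$ for $n,m\in\operatorname{dom}\alpha$. $\mathscr{I}^{\nearrow}_{\infty}(\mathbb{Z})$ is the set of all injective monotone partial maps $\alpha\colon\mathbb{Z}\rightharpoonup\mathbb{Z}$ with $|\mathbb{Z}\setminus\operatorname{dom}\alpha|<\infty$ and $|\mathbb{Z}\setminus\operatorname{ran}\alpha|<\infty$, with composition $x(\alpha\beta)=(x\alpha)\beta$ for $x\in\operatorname{dom}(\alpha\beta)=\{y\in\operatorname{dom}\alpha\mid y\alpha\in\operatorname{dom}\beta\}$ (maps are written on the right). A homomorphism of semigroups is annihilating if it is constant (its image is a single element); a monomorphism is an injective homomorphism. A subgroup of a semigroup $S$ is a subsemigroup which is a group under the induced operation. *)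

theory Defs
  imports "HOL-Algebra.Group"
begin

(* Semigroups reuse the monoid records of HOL-Algebra, so that hom and group apply to them;
   the field "one" of a semigroup is unconstrained and carries no meaning. *)
locale semigroup_on =
  fixes S (structure)
  assumes m_closed: "\<lbrakk>x \<in> carrier S; y \<in> carrier S\<rbrakk> \<Longrightarrow> x \<otimes> y \<in> carrier S"
    and m_assoc: "\<lbrakk>x \<in> carrier S; y \<in> carrier S; z \<in> carrier S\<rbrakk> \<Longrightarrow>
      (x \<otimes> y) \<otimes> z = x \<otimes> (y \<otimes> z)"

(* The identity e of the subgroup is an arbitrary idempotent of S, unrelated to "one S";
   hence the library predicate subgroup, which demands one S \<in> H, is not applicable.
   Closure of H under the operation of S is part of the group predicate. *)
definition subgroup_of_semigroup :: "'s set \<Rightarrow> ('s, 'm) monoid_scheme \<Rightarrow> bool" where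
  "subgroup_of_semigroup H S \<longleftrightarrow>
     H \<subseteq> carrier S \<and> (\<exists>e\<in>H. group (S\<lparr>carrier := H, one := e\<rparr>))"

definition annihilating :: "('a, 'm) monoid_scheme \<Rightarrow> ('a \<Rightarrow> 's) \<Rightarrow> bool" where
  "annihilating G h \<longleftrightarrow> is_singleton (h ` carrier G)"

definition monotone_pmap :: "(int \<rightharpoonup> int) \<Rightarrow> bool" where
  "monotone_pmap \<alpha> \<longleftrightarrow>
     (\<forall>n\<in>dom \<alpha>. \<forall>m\<in>dom \<alpha>. n \<le> m \<longrightarrow> the (\<alpha> n) \<le> the (\<alpha> m))"

(* Maps act on the right, so the product of \<alpha> and \<beta> applies \<alpha> first. *)
definition IZ :: "(int \<rightharpoonup> int) monoid" where
  "IZ = \<lparr>carrier = {\<alpha>. inj_on \<alpha> (dom \<alpha>) \<and> monotone_pmap \<alpha> \<and>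
                        finite (UNIV - dom \<alpha>) \<and> finite (UNIV - ran \<alpha>)},
         mult = (\<lambda>\<alpha> \<beta>. \<beta> \<circ>\<^sub>m \<alpha>),
         one = Some\<rparr>"

lemma IZ_mult_dom: "dom (\<alpha> \<otimes>\<^bsub>IZ\<^esub> \<beta>) = {y \<in> dom \<alpha>. the (\<alpha> y) \<in> dom \<beta>}"
  by (auto simp: IZ_def map_comp_def split: option.splits)

lemma IZ_mult_apply: "x \<in> dom (\<alpha> \<otimes>\<^bsub>IZ\<^esub> \<beta>) \<Longrightarrow> (\<alpha> \<otimes>\<^bsub>IZ\<^esub> \<beta>) x = \<beta> (the (\<alpha> x))"
  by (auto simp: IZ_def map_comp_def split: option.splits)

lemma IZ_mult_closed:
  assumes "\<alpha> \<in> carrier IZ" "\<beta> \<in> carrier IZ"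
  shows "\<alpha> \<otimes>\<^bsub>IZ\<^esub> \<beta> \<in> carrier IZ"
proof -
  have inj: "inj_on \<alpha> (dom \<alpha>)" "inj_on \<beta> (dom \<beta>)"
    and mono: "monotone_pmap \<alpha>" "monotone_pmap \<beta>"
    and fin: "finite (- dom \<alpha>)" "finite (- ran \<alpha>)" "finite (- dom \<beta>)" "finite (- ran \<beta>)"
    using assms by (auto simp: IZ_def Compl_eq_Diff_UNIV)
  let ?c = "\<beta> \<circ>\<^sub>m \<alpha>"
  have "inj_on ?c (dom ?c)"
  proof (rule inj_onI)
    fix x y assume "x \<in> dom ?c" "y \<in> dom ?c" and eq: "?c x = ?c y"
    then obtain u v w where "\<alpha> x = Some u" "\<alpha> y = Some v" "\<beta> u = Some w" "\<beta> v = Some w"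
      by (auto simp: map_comp_Some_iff)
    with inj show "x = y" by (metis domI inj_onD)
  qed
  moreover have "monotone_pmap ?c"
    unfolding monotone_pmap_def
  proof (intro ballI impI)
    fix n m assume "n \<in> dom ?c" "m \<in> dom ?c" and le: "n \<le> m"
    then obtain u v w z where "\<alpha> n = Some u" "\<alpha> m = Some v" "\<beta> u = Some w" "\<beta> v = Some z"
      by (auto simp: map_comp_Some_iff)
    with mono le show "the (?c n) \<le> the (?c m)"
      unfolding monotone_pmap_def by (metis domI map_comp_simps(2) option.sel)
  qed
  moreover have "finite (- dom ?c)"
  proof (rule finite_subset)
    show "- dom ?c \<subseteq> - dom \<alpha> \<union> {x \<in> dom \<alpha>. \<alpha> x \<in> Some ` (- dom \<beta>)}"
      by (auto simp: map_comp_def split: option.splits)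
    have "finite (\<alpha> -` (Some ` (- dom \<beta>)) \<inter> dom \<alpha>)"
      using fin inj by (intro finite_vimage_IntI) auto
    then show "finite (- dom \<alpha> \<union> {x \<in> dom \<alpha>. \<alpha> x \<in> Some ` (- dom \<beta>)})"
      using fin by (simp add: vimage_def Int_def conj_commute)
  qed
  moreover have "finite (- ran ?c)"
  proof (rule finite_subset)
    show "- ran ?c \<subseteq> - ran \<beta> \<union> (\<lambda>y. the (\<beta> y)) ` (- ran \<alpha>)"
    proof
      fix z assume z: "z \<in> - ran ?c"
      show "z \<in> - ran \<beta> \<union> (\<lambda>y. the (\<beta> y)) ` (- ran \<alpha>)"
      proof (cases "z \<in> ran \<beta>")
        case True
        then obtain y where y: "\<beta> y = Some z" by (auto simp: ran_def)
        have "y \<notin> ran \<alpha>"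
        proof
          assume "y \<in> ran \<alpha>"
          then obtain x where "\<alpha> x = Some y" by (auto simp: ran_def)
          with y have "?c x = Some z" by simp
          with z show False by (auto simp: ran_def)
        qed
        with y show ?thesis by force
      qed simp
    qed
  qed (use fin in simp)
  ultimately show ?thesis
    by (simp add: IZ_def Compl_eq_Diff_UNIV)
qed

lemma monoid_IZ: "monoid IZ"
proof (rule monoidI)
  show "\<one>\<^bsub>IZ\<^esub> \<in> carrier IZ"
    by (auto simp: IZ_def monotone_pmap_def inj_on_def ran_def dom_def)
qed (simp_all add: IZ_mult_closed, simp_all add: IZ_def map_comp_def fun_eq_iff split: option.splits)

end

(* If h identifies two distinct elements, then multiplying by suitable partial identities and
   inverses yields a cofinite set A and x in A such that h identifies the partial identities of A
   and of A - {x}. For every y there is a total monotone injection \<gamma> from Z into A with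
   \<gamma> y = x; cutting it down by these two partial identities and cancelling \<gamma> shows that h sends
   the partial identity of Z - {y} to h 1. Hence h sends every idempotent to h 1, and since every
   \<alpha> has a partial inverse with product an idempotent, the image is a group with identity h 1. *)
theory Submission
  imports Defs
begin

section \<open>Strict monotonicity of the maps\<close>

text \<open>On a linear order, injective and monotone together amount to strictly monotone. Stated
  on the graph, this single condition is convenient to check for the maps built below.\<close>

lemma IZ_iff:
  "\<alpha> \<in> carrier IZ \<longleftrightarrow>
     (\<forall>x y u v. \<alpha> x = Some u \<longrightarrow> \<alpha> y = Some v \<longrightarrow> x < y \<longrightarrow> u < v) \<and>
     finite (- dom \<alpha>) \<and> finite (- ran \<alpha>)" (is "_ \<longleftrightarrow> ?mono \<and> _")
proof -
  have eq: "inj_on \<alpha> (dom \<alpha>) \<and> monotone_pmap \<alpha> \<longleftrightarrow> ?mono"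
  proof (intro iffI allI impI)
    fix x y u v
    assume *: "inj_on \<alpha> (dom \<alpha>) \<and> monotone_pmap \<alpha>"
      and xy: "\<alpha> x = Some u" "\<alpha> y = Some v" "x < y"
    have dom: "x \<in> dom \<alpha>" "y \<in> dom \<alpha>" using xy by auto
    have "the (\<alpha> x) \<le> the (\<alpha> y)"
      using * dom xy(3) unfolding monotone_pmap_def by (blast intro: less_imp_le)
    moreover have "\<alpha> x \<noteq> \<alpha> y"
      using inj_onD[of \<alpha> "dom \<alpha>" x y] * dom xy(3) by (metis less_irrefl)
    ultimately show "u < v" using xy by simp
  next
    assume ?mono
    then have m: "u < v" if "\<alpha> x = Some u" "\<alpha> y = Some v" "x < y" for x y u v
      using that by blast
    have "inj_on \<alpha> (dom \<alpha>)"
    proof (rule inj_onI)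
      fix x y assume "x \<in> dom \<alpha>" "y \<in> dom \<alpha>" "\<alpha> x = \<alpha> y"
      then obtain u where "\<alpha> x = Some u" "\<alpha> y = Some u" by auto
      then show "x = y" using m[of x u y u] m[of y u x u] by linarith
    qed
    moreover have "monotone_pmap \<alpha>"
      unfolding monotone_pmap_def
    proof (intro ballI impI)
      fix x y assume "x \<in> dom \<alpha>" "y \<in> dom \<alpha>" and le: "x \<le> y"
      then obtain u v where uv: "\<alpha> x = Some u" "\<alpha> y = Some v" by blast
      show "the (\<alpha> x) \<le> the (\<alpha> y)"
      proof (cases "x = y")
        case False
        then have "u < v" using m[OF uv] le by simp
        then show ?thesis using uv by simp
      qed simp
    qed
    ultimately show "inj_on \<alpha> (dom \<alpha>) \<and> monotone_pmap \<alpha>" ..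
  qed
  have "\<alpha> \<in> carrier IZ \<longleftrightarrow> (inj_on \<alpha> (dom \<alpha>) \<and> monotone_pmap \<alpha>) \<and>
      finite (- dom \<alpha>) \<and> finite (- ran \<alpha>)"
    by (simp add: IZ_def Compl_eq_Diff_UNIV)
  then show ?thesis unfolding eq .
qed

text \<open>Totality of the order makes a strictly monotone map reflect the order as well; this is
  what inverses need.\<close>

lemma IZ_strict_mono:
  assumes "\<alpha> \<in> carrier IZ" "\<alpha> x = Some u" "\<alpha> y = Some v"
  shows "u < v \<longleftrightarrow> x < y"
proof -
  have *: "\<And>x y u v. \<lbrakk>\<alpha> x = Some u; \<alpha> y = Some v; x < y\<rbrakk> \<Longrightarrow> u < v"
    using assms(1) unfolding IZ_iff by blast
  show ?thesis
  proof (cases x y rule: linorder_cases)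
    case less
    with *[OF assms(2,3)] show ?thesis by simp
  next
    case equal
    with assms show ?thesis by simp
  next
    case greater
    with *[OF assms(3,2)] show ?thesis by simp
  qed
qed

lemma IZ_inj:
  assumes "\<alpha> \<in> carrier IZ" "\<alpha> x = Some u" "\<alpha> y = Some u"
  shows "x = y"
  using IZ_strict_mono[OF assms] IZ_strict_mono[OF assms(1,3,2)] by auto

lemma IZ_mult: "\<alpha> \<otimes>\<^bsub>IZ\<^esub> \<beta> = \<beta> \<circ>\<^sub>m \<alpha>"
  by (simp add: IZ_def)

lemma IZ_one: "\<one>\<^bsub>IZ\<^esub> = Some |` UNIV"
  by (simp add: IZ_def restrict_map_def)

section \<open>Partial inverses and partial identities\<close>

text \<open>The semigroup inverse of \<alpha>; for \<alpha> in \<open>IZ\<close>, injectivity makes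
  the choice unique.\<close>

definition pinverse :: "(int \<rightharpoonup> int) \<Rightarrow> (int \<rightharpoonup> int)" where
  "pinverse \<alpha> y = (if y \<in> ran \<alpha> then Some (SOME x. \<alpha> x = Some y) else None)"

lemma pinverse_eq_Some_iff:
  assumes "\<alpha> \<in> carrier IZ"
  shows "pinverse \<alpha> y = Some x \<longleftrightarrow> \<alpha> x = Some y"
proof
  assume "pinverse \<alpha> y = Some x"
  then have ex: "\<exists>x. \<alpha> x = Some y" and x: "x = (SOME x. \<alpha> x = Some y)"
    unfolding pinverse_def ran_def by (auto split: if_splits)
  from someI_ex[OF ex] show "\<alpha> x = Some y" unfolding x .
next
  assume x: "\<alpha> x = Some y"
  then have "(SOME x. \<alpha> x = Some y) = x"
    using IZ_inj[OF assms] by (intro some_equality) blast+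
  with x show "pinverse \<alpha> y = Some x" by (auto simp: pinverse_def ran_def)
qed

text \<open>Inversion swaps domain and range, hence the two cofiniteness conditions; strict
  monotonicity follows from order reflection.\<close>

lemma pinverse_closed:
  assumes "\<alpha> \<in> carrier IZ"
  shows "pinverse \<alpha> \<in> carrier IZ"
proof -
  have "dom (pinverse \<alpha>) = ran \<alpha>" "ran (pinverse \<alpha>) = dom \<alpha>"
    by (auto simp: dom_def ran_def pinverse_eq_Some_iff[OF assms])
  then show ?thesis
    using assms IZ_strict_mono[OF assms]
    unfolding IZ_iff pinverse_eq_Some_iff[OF assms] by simp
qed

lemma pid_closed:
  assumes "finite (- A)"
  shows "Some |` A \<in> carrier IZ"
proof -
  have "dom (Some |` A) = A" "ran (Some |` A) = A"
    by (auto simp: restrict_map_def ran_def split: if_splits)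
  with assms show ?thesis by (auto simp: IZ_iff restrict_map_def split: if_splits)
qed

lemma pid_mult: "(Some |` A) \<otimes>\<^bsub>IZ\<^esub> \<alpha> = \<alpha> |` A"
  by (auto simp: IZ_mult restrict_map_def map_comp_def fun_eq_iff)

text \<open>Going along \<alpha> and back fixes each point that survives the restriction. This
  cancels \<alpha>, turning equalities between images of restrictions of \<alpha> into equalities
  between images of idempotents.\<close>

lemma mult_pinverse_restrict:
  assumes "\<alpha> \<in> carrier IZ"
  shows "(\<alpha> |` A) \<otimes>\<^bsub>IZ\<^esub> pinverse \<alpha> = Some |` (A \<inter> dom \<alpha>)"
proof
  fix x
  show "((\<alpha> |` A) \<otimes>\<^bsub>IZ\<^esub> pinverse \<alpha>) x = (Some |` (A \<inter> dom \<alpha>)) x"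
  proof (cases "\<alpha> x")
    case (Some y)
    then have "pinverse \<alpha> y = Some x" by (simp add: pinverse_eq_Some_iff[OF assms])
    with Some show ?thesis by (auto simp: IZ_mult restrict_map_def map_comp_def)
  qed (auto simp: IZ_mult restrict_map_def map_comp_def)
qed

lemma mult_pinverse:
  assumes "\<alpha> \<in> carrier IZ"
  shows "\<alpha> \<otimes>\<^bsub>IZ\<^esub> pinverse \<alpha> = Some |` dom \<alpha>"
    and "pinverse \<alpha> \<otimes>\<^bsub>IZ\<^esub> \<alpha> = Some |` ran \<alpha>"
proof -
  have "\<alpha> |` UNIV = \<alpha>" by (simp add: restrict_map_def)
  then show "\<alpha> \<otimes>\<^bsub>IZ\<^esub> pinverse \<alpha> = Some |` dom \<alpha>"
    using mult_pinverse_restrict[OF assms, of UNIV] by simp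
  show "pinverse \<alpha> \<otimes>\<^bsub>IZ\<^esub> \<alpha> = Some |` ran \<alpha>"
  proof
    fix y
    show "(pinverse \<alpha> \<otimes>\<^bsub>IZ\<^esub> \<alpha>) y = (Some |` ran \<alpha>) y"
    proof (cases "pinverse \<alpha> y")
      case None
      then have "y \<notin> ran \<alpha>" by (simp add: pinverse_def split: if_splits)
      with None show ?thesis by (simp add: IZ_mult map_comp_def)
    next
      case (Some x)
      then have "\<alpha> x = Some y" by (simp add: pinverse_eq_Some_iff[OF assms])
      with Some show ?thesis by (auto simp: IZ_mult map_comp_def ran_def restrict_map_def)
    qed
  qed
qed

text \<open>Points on either side of \<open>y\<close> are shifted outwards past the finite
  complement of \<open>A\<close>, which leaves room to send \<open>y\<close> to
  \<open>x\<close>.\<close>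

lemma exists_embedding:
  assumes "finite (- A)" "x \<in> A"
  obtains \<gamma> where "\<gamma> \<in> carrier IZ" "dom \<gamma> = UNIV" "ran \<gamma> \<subseteq> A" "\<gamma> y = Some x"
proof -
  \<comment> \<open>The 0 keeps the maximum meaningful when \<open>A\<close> is all of the
    integers.\<close>
  define N where "N = Max (insert 0 (abs ` (- A))) + 1"
  have N: "\<bar>z\<bar> < N" if "z \<notin> A" for z
  proof -
    have "\<bar>z\<bar> \<le> Max (insert 0 (abs ` (- A)))"
      using assms(1) that by (intro Max_ge) auto
    then show ?thesis by (simp add: N_def)
  qed
  \<comment> \<open>The summands for \<open>x\<close> and \<open>y\<close> push images from the left
    of \<open>y\<close> below both \<open>- N\<close> and \<open>x\<close>, and images from the
    right above both \<open>N\<close> and \<open>x\<close>.\<close>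
  define K where "K = \<bar>N\<bar> + \<bar>x\<bar> + \<bar>y\<bar>"
  define f where "f n = (if n < y then n - K else if n = y then x else n + K)" for n :: int
  define \<gamma> where "\<gamma> n = Some (f n)" for n
  have "- ran \<gamma> \<subseteq> {y - K..y + K}"
  proof
    fix z assume z: "z \<in> - ran \<gamma>"
    have "f (z + K) = z" if "z < y - K" using that by (simp add: f_def)
    moreover have "f (z - K) = z" if "z > y + K" using that by (simp add: f_def)
    ultimately show "z \<in> {y - K..y + K}"
      using z by (fastforce simp: \<gamma>_def ran_def not_less[symmetric])
  qed
  then have "finite (- ran \<gamma>)" by (rule finite_subset) simp
  moreover have "f a < f b" if "a < b" for a b
    using that by (auto simp: f_def K_def)
  moreover have "f n \<in> A" for n
    using assms(2) N[of "f n"] by (cases n y rule: linorder_cases) (force simp: f_def K_def)+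
  moreover have "f y = x" by (simp add: f_def)
  ultimately show ?thesis
    by (intro that[of \<gamma>]) (auto simp: IZ_iff \<gamma>_def ran_def dom_def)
qed

section \<open>Collisions under a homomorphism\<close>

text \<open>Deleting \<open>x\<close> leaves \<beta> unchanged, so \<open>h\<close> cannot tell
  \<alpha> from \<alpha> without \<open>x\<close>; multiplying by \<open>pinverse \<alpha>\<close>
  carries this over to idempotents.\<close>

lemma identified_dom:
  assumes h: "h \<in> hom IZ S"
    and \<alpha>: "\<alpha> \<in> carrier IZ" and \<beta>: "\<beta> \<in> carrier IZ"
    and eq: "h \<alpha> = h \<beta>" and x: "x \<in> dom \<alpha>" "x \<notin> dom \<beta>"
  shows "h (Some |` (dom \<alpha> - {x})) = h (Some |` dom \<alpha>)"
proof -
  note hm = hom_mult[OF h]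
  let ?e = "Some |` (- {x})"
  have e: "?e \<in> carrier IZ" by (rule pid_closed) simp
  have "\<beta> |` (- {x}) = \<beta>"
    using x(2) by (simp add: restrict_map_def fun_eq_iff domIff)
  then have "h (\<alpha> |` (- {x})) = h \<alpha>"
    using hm[OF e \<alpha>] hm[OF e \<beta>] eq by (simp add: pid_mult)
  moreover have "\<alpha> |` (- {x}) \<in> carrier IZ"
    using IZ_mult_closed[OF e \<alpha>] by (simp add: pid_mult)
  ultimately have "h ((\<alpha> |` (- {x})) \<otimes>\<^bsub>IZ\<^esub> pinverse \<alpha>) = h (\<alpha> \<otimes>\<^bsub>IZ\<^esub> pinverse \<alpha>)"
    using hm \<alpha> pinverse_closed by metis
  moreover have "- {x} \<inter> dom \<alpha> = dom \<alpha> - {x}" by auto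
  ultimately show ?thesis
    using \<alpha> by (simp add: mult_pinverse_restrict mult_pinverse)
qed

text \<open>By \<open>identified_dom\<close>, a collision between maps with different domains
  suffices. Maps with a common domain differ in a value, and a multiplication on the right turns
  this into a difference of domains.\<close>

lemma identified_pids:
  assumes h: "h \<in> hom IZ S" and ninj: "\<not> inj_on h (carrier IZ)"
  obtains A x where "finite (- A)" "x \<in> A" "h (Some |` (A - {x})) = h (Some |` A)"
proof -
  have "\<exists>\<alpha> \<beta> x. \<alpha> \<in> carrier IZ \<and> \<beta> \<in> carrier IZ \<and> h \<alpha> = h \<beta> \<and> x \<in> dom \<alpha> - dom \<beta>"
  proof -
    obtain \<alpha> \<beta> where ab: "\<alpha> \<in> carrier IZ" "\<beta> \<in> carrier IZ" "h \<alpha> = h \<beta>" "\<alpha> \<noteq> \<beta>"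
      using ninj by (auto simp: inj_on_def)
    show ?thesis
    proof (cases "dom \<alpha> = dom \<beta>")
      case False
      then show ?thesis using ab by (metis Diff_iff subset_antisym subsetI)
    next
      case True
      then obtain x u v where xuv: "\<alpha> x = Some u" "\<beta> x = Some v" "u \<noteq> v"
        using ab(4) by (metis domD domIff ext)
      \<comment> \<open>Deleting \<open>u\<close> from both ranges removes \<open>x\<close> from the domain of \<open>\<alpha>\<close> only.\<close>
      let ?e = "Some |` (- {u})"
      have e: "?e \<in> carrier IZ" by (rule pid_closed) simp
      have "h (\<beta> \<otimes>\<^bsub>IZ\<^esub> ?e) = h (\<alpha> \<otimes>\<^bsub>IZ\<^esub> ?e)"
        using hom_mult[OF h] ab e by metis
      moreover have "x \<in> dom (\<beta> \<otimes>\<^bsub>IZ\<^esub> ?e) - dom (\<alpha> \<otimes>\<^bsub>IZ\<^esub> ?e)"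
        using xuv by (auto simp: IZ_mult_dom)
      ultimately show ?thesis
        using IZ_mult_closed[OF ab(1) e] IZ_mult_closed[OF ab(2) e] by blast
    qed
  qed
  then obtain \<alpha> \<beta> x where *: "\<alpha> \<in> carrier IZ" "\<beta> \<in> carrier IZ" "h \<alpha> = h \<beta>"
    "x \<in> dom \<alpha>" "x \<notin> dom \<beta>" by blast
  show ?thesis
    using identified_dom[OF h *] * by (intro that[of "dom \<alpha>" x]) (auto simp: IZ_iff)
qed

lemma pid_collapse:
  assumes h: "h \<in> hom IZ S" and ninj: "\<not> inj_on h (carrier IZ)"
    and B: "finite (- B)"
  shows "h (Some |` B) = h \<one>\<^bsub>IZ\<^esub>"
proof -
  interpret IZ: monoid IZ by (rule monoid_IZ)
  note hm = hom_mult[OF h]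
  obtain A x where A: "finite (- A)" "x \<in> A" "h (Some |` (A - {x})) = h (Some |` A)"
    using identified_pids[OF h ninj] .
  have "- (A - {x}) = insert x (- A)" by auto
  then have c: "Some |` A \<in> carrier IZ" "Some |` (A - {x}) \<in> carrier IZ"
    using A(1) by (simp_all add: pid_closed)
  have point: "h (Some |` (- {y})) = h \<one>\<^bsub>IZ\<^esub>" for y
  proof -
    obtain \<gamma> where g: "\<gamma> \<in> carrier IZ" "dom \<gamma> = UNIV" "ran \<gamma> \<subseteq> A" "\<gamma> y = Some x"
      using exists_embedding[OF A(1,2)] .
    have 1: "\<gamma> \<otimes>\<^bsub>IZ\<^esub> (Some |` A) = \<gamma>"
      using g(3) by (auto simp: IZ_mult map_comp_def restrict_map_def fun_eq_iff ran_def
          split: option.splits)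
    \<comment> \<open>By injectivity \<open>y\<close> is the only preimage of \<open>x\<close>, so
      deleting \<open>x\<close> after \<gamma> is deleting \<open>y\<close> before it.\<close>
    have 2: "\<gamma> \<otimes>\<^bsub>IZ\<^esub> (Some |` (A - {x})) = \<gamma> |` (- {y})"
      using g(3,4) IZ_inj[OF g(1)]
      by (auto simp: IZ_mult map_comp_def restrict_map_def fun_eq_iff ran_def
          split: option.splits)
    have "h (\<gamma> |` (- {y})) = h \<gamma>"
      using hm[OF g(1) c(1)] hm[OF g(1) c(2)] A(3) by (simp add: 1 2)
    moreover have "\<gamma> |` (- {y}) \<in> carrier IZ"
      using IZ_mult_closed[OF g(1) c(2)] by (simp add: 2)
    ultimately have "h ((\<gamma> |` (- {y})) \<otimes>\<^bsub>IZ\<^esub> pinverse \<gamma>) = h (\<gamma> \<otimes>\<^bsub>IZ\<^esub> pinverse \<gamma>)"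
      using hm g(1) pinverse_closed by metis
    then show ?thesis
      by (simp add: mult_pinverse_restrict[OF g(1)] mult_pinverse(1)[OF g(1)] g(2) IZ_one)
  qed
  \<comment> \<open>A cofinite partial identity is a finite product of those omitting one point, and
    \<open>h\<close> sends each factor to the idempotent \<open>h \<one>\<close>.\<close>
  have "h (Some |` (- F)) = h \<one>\<^bsub>IZ\<^esub>" if "finite F" for F
    using that
  proof (induction F)
    case empty
    then show ?case by (simp add: IZ_one)
  next
    case (insert y F)
    have c: "Some |` (- {y}) \<in> carrier IZ" "Some |` (- F) \<in> carrier IZ"
      using insert.hyps by (simp_all add: pid_closed)
    have "- insert y F = - F \<inter> - {y}" by auto
    then have "Some |` (- insert y F) = (Some |` (- {y})) \<otimes>\<^bsub>IZ\<^esub> (Some |` (- F))"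
      by (simp add: pid_mult)
    then have "h (Some |` (- insert y F)) = h \<one>\<^bsub>IZ\<^esub> \<otimes>\<^bsub>S\<^esub> h \<one>\<^bsub>IZ\<^esub>"
      using hm[OF c] insert.IH point by simp
    also have "\<dots> = h \<one>\<^bsub>IZ\<^esub>"
      using hm[OF IZ.one_closed IZ.one_closed] by simp
    finally show ?case .
  qed
  from this[OF B] show ?thesis by simp
qed

theorem theorem2p7:
  fixes S :: "('s, 'm) monoid_scheme"
    and h :: "(int \<rightharpoonup> int) \<Rightarrow> 's"
  assumes "semigroup_on S"
    and "h \<in> hom IZ S"
    and "\<not> annihilating IZ h"
  shows "inj_on h (carrier IZ) \<or> subgroup_of_semigroup (h ` carrier IZ) S"
proof (unfold disj_imp, rule impI)
  assume ninj: "\<not> inj_on h (carrier IZ)"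
  interpret IZ: monoid IZ by (rule monoid_IZ)
  interpret S: semigroup_on S by (rule assms(1))
  note hm = hom_mult[OF assms(2), symmetric]
  have sub: "h ` carrier IZ \<subseteq> carrier S"
    using assms(2) by (auto simp: hom_def)
  let ?G = "S\<lparr>carrier := h ` carrier IZ, one := h \<one>\<^bsub>IZ\<^esub>\<rparr>"
  have "group ?G"
  \<comment> \<open>Left inverses suffice here: \<open>h (pinverse \<alpha>)\<close> serves for
    \<open>h \<alpha>\<close>, because the product is the image of a cofinite partial identity and
    so collapses to \<open>h \<one>\<close>.\<close>
  proof (rule groupI)
    fix a assume "a \<in> carrier ?G"
    then obtain \<alpha> where \<alpha>: "\<alpha> \<in> carrier IZ" "a = h \<alpha>" by auto
    then have "h (pinverse \<alpha>) \<otimes>\<^bsub>S\<^esub> a = h (Some |` ran \<alpha>)"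
      by (simp add: hm pinverse_closed mult_pinverse)
    also have "\<dots> = h \<one>\<^bsub>IZ\<^esub>"
      using \<alpha> by (intro pid_collapse[OF assms(2) ninj]) (simp add: IZ_iff)
    finally show "\<exists>b\<in>carrier ?G. b \<otimes>\<^bsub>?G\<^esub> a = \<one>\<^bsub>?G\<^esub>"
      using pinverse_closed[OF \<alpha>(1)] by auto
  next
    fix a b c assume "a \<in> carrier ?G" "b \<in> carrier ?G" "c \<in> carrier ?G"
    then show "a \<otimes>\<^bsub>?G\<^esub> b \<otimes>\<^bsub>?G\<^esub> c = a \<otimes>\<^bsub>?G\<^esub> (b \<otimes>\<^bsub>?G\<^esub> c)"
      using sub S.m_assoc by (simp add: subset_iff)
  qed (auto simp: hm)
  then show "subgroup_of_semigroup (h ` carrier IZ) S"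
    unfolding subgroup_of_semigroup_def using sub IZ.one_closed by blast
qed

end
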